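(* Let $n \ge 3$ and $v, w \in \mathfrak{S}_n$. The intersection $B(v) \cap B(w)$ is not boolean if and only if $\sigma_k\sigma_{k+1}\sigma_k \in B(v) \cap B(w)$ for some $k \in [1,n-2]$. Equivalently, $B(v) \cap B(w)$ fails to be boolean if and only if there exists $k \in [1,n-2]$ such that $k$ and $k+1$ are interlaced in both $v$ and $w$.
   Context: $\mathfrak{S}_n$ is the symmetric group, generated by the adjacent transpositions $\sigma_i=(i\ i+1)$, $i\in[1,n-1]$, and ordered by the Bruhat order. Permutations are composed right to left; a reduced word for $w$ is a word $a_1a_2\cdots a_\ell$ in the letters $[1,n-1]$ with $w=\sigma_{a_1}\cdots\sigma_{a_\ell}$ and $\ell$ equal to the length of $w$. For $w\in\mathfrak{S}_n$, $B(w)=\{u \in \mathfrak{S}_n : u \le w\}$ is the principal order ideal of $w$ in the Bruhat order. A permutation $u$ is boolean if $B(u)$ is isomorphic (as a poset) to a boolean algebra; an order ideal in the Bruhat order is boolean if all of its elements are boolean permutations. For $k\in[1,n-2]$, the letters $k$ and $k+1$ are interlaced in $w$ if the reduced words of $w$ contain both letters $k$ and $k+1$ and some reduced word of $w$ contains a (not necessarily consecutive) subsequence of the form $k,\,k+1,\,k$ or of the form $k+1,\,k,\,k+1$ (equivalently, every reduced word of $w$ does). *)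

theory Defs
  imports "HOL-Library.Sublist" "HOL-Combinatorics.Permutations"
begin

definition adj :: "nat \<Rightarrow> nat \<Rightarrow> nat" where
  "adj i = transpose i (Suc i)"

text \<open>Products of permutations are functional compositions, read right to left.\<close>

definition word_perm :: "nat list \<Rightarrow> nat \<Rightarrow> nat" where
  "word_perm a = foldr (\<circ>) (map adj a) id"

definition is_word :: "nat \<Rightarrow> (nat \<Rightarrow> nat) \<Rightarrow> nat list \<Rightarrow> bool" where
  "is_word n w a \<longleftrightarrow> set a \<subseteq> {1..n - 1} \<and> word_perm a = w"

text \<open>Coxeter length; it is only meaningful if \<open>w permutes {1..n}\<close>.\<close>

definition perm_length :: "nat \<Rightarrow> (nat \<Rightarrow> nat) \<Rightarrow> nat" where
  "perm_length n w = (LEAST l. \<exists>a. is_word n w a \<and> length a = l)"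

definition reduced_word :: "nat \<Rightarrow> (nat \<Rightarrow> nat) \<Rightarrow> nat list \<Rightarrow> bool" where
  "reduced_word n w a \<longleftrightarrow> is_word n w a \<and> length a = perm_length n w"

text \<open>The Bruhat order is the reflexive transitive closure of \<open>u \<rightarrow> u t\<close>, where \<open>t\<close> is a
  reflection (an arbitrary transposition) and the length strictly increases.\<close>

definition bruhat_step :: "nat \<Rightarrow> (nat \<Rightarrow> nat) \<Rightarrow> (nat \<Rightarrow> nat) \<Rightarrow> bool" where
  "bruhat_step n u v \<longleftrightarrow>
     (\<exists>i j. 1 \<le> i \<and> i < j \<and> j \<le> n \<and> v = u \<circ> transpose i j) \<and>
     perm_length n u < perm_length n v"

definition bruhat_le :: "nat \<Rightarrow> (nat \<Rightarrow> nat) \<Rightarrow> (nat \<Rightarrow> nat) \<Rightarrow> bool" where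
  "bruhat_le n = (bruhat_step n)\<^sup>*\<^sup>*"

definition principal_ideal :: "nat \<Rightarrow> (nat \<Rightarrow> nat) \<Rightarrow> (nat \<Rightarrow> nat) set" where
  "principal_ideal n w = {u. u permutes {1..n} \<and> bruhat_le n u w}"

text \<open>As usual in combinatorics, and since \<open>principal_ideal n u\<close> is finite, a boolean algebra is
  the poset of all subsets of \<open>{1..r}\<close>, ordered by inclusion, for some \<open>r\<close>.\<close>

definition boolean_perm :: "nat \<Rightarrow> (nat \<Rightarrow> nat) \<Rightarrow> bool" where
  "boolean_perm n u \<longleftrightarrow>
     (\<exists>(r::nat) f. bij_betw f (principal_ideal n u) (Pow {1..r}) \<and>
        (\<forall>x \<in> principal_ideal n u. \<forall>y \<in> principal_ideal n u.
           bruhat_le n x y \<longleftrightarrow> f x \<subseteq> f y))"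

definition boolean_ideal :: "nat \<Rightarrow> (nat \<Rightarrow> nat) set \<Rightarrow> bool" where
  "boolean_ideal n I \<longleftrightarrow> (\<forall>u \<in> I. boolean_perm n u)"

definition interlaced :: "nat \<Rightarrow> (nat \<Rightarrow> nat) \<Rightarrow> nat \<Rightarrow> bool" where
  "interlaced n w k \<longleftrightarrow>
     (\<forall>a. reduced_word n w a \<longrightarrow> k \<in> set a \<and> Suc k \<in> set a) \<and>
     (\<exists>a. reduced_word n w a \<and> (subseq [k, Suc k, k] a \<or> subseq [Suc k, k, Suc k] a))"

end

theory Submission imports Defs
begin

text \<open>
  If \<open>i < j\<close> and \<open>w i > w j\<close>, then in any word of \<open>w\<close> some letter swaps the two values,
  and deleting this letter yields a word of \<open>w (i j)\<close>. Hence length comparisons along a Bruhat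
  step are comparisons of values, and everything below \<open>w\<close> is a subword of any given word of \<open>w\<close>;
  conversely all subwords of a reduced word of \<open>w\<close> lie below \<open>w\<close>.
  A word of \<open>\<sigma>\<^sub>k \<sigma>\<^sub>k\<^sub>+\<^sub>1 \<sigma>\<^sub>k\<close> must interlace \<open>k\<close> and \<open>k + 1\<close>, since a word in which
  one of the two letters only occurs before the other cannot exchange \<open>k\<close> and \<open>k + 2\<close>; so
  \<open>\<sigma>\<^sub>k \<sigma>\<^sub>k\<^sub>+\<^sub>1 \<sigma>\<^sub>k \<le> w\<close> expresses interlacing. If a reduced word of \<open>w\<close>
  repeats a letter \<open>c\<close>, some \<open>c \<plusminus> 1\<close> lies between the two occurrences; if its letters are
  distinct, then the ideal of \<open>w\<close> is the boolean algebra of all sets of letters of the word. Finally, the ideal of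
  \<open>\<sigma>\<^sub>k \<sigma>\<^sub>k\<^sub>+\<^sub>1 \<sigma>\<^sub>k\<close> is not boolean because it has six elements.
\<close>

section \<open>Words and the permutations they represent\<close>

lemma set_mono_subseq: "subseq a b \<Longrightarrow> set a \<subseteq> set b"
  by (induction rule: list_emb.induct) auto

lemma word_perm_Nil [simp]: "word_perm [] = id"
  by (simp add: word_perm_def)

lemma word_perm_Cons [simp]: "word_perm (c # a) = adj c \<circ> word_perm a"
  by (simp add: word_perm_def)

lemma word_perm_append [simp]: "word_perm (a @ b) = word_perm a \<circ> word_perm b"
  by (induction a) (auto simp: comp_assoc)

lemma adj_adj [simp]: "adj c (adj c x) = x"
  by (simp add: adj_def)

lemma adj_comp_adj [simp]: "adj c \<circ> adj c = id"
  by (simp add: fun_eq_iff)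

lemma bij_word_perm: "bij (word_perm a)"
proof (induction a)
  case (Cons c a)
  have "bij (adj c)" by (simp add: adj_def)
  with Cons show ?case by (simp only: word_perm_Cons bij_comp)
qed (simp only: word_perm_Nil bij_id)

lemma word_perm_eq_iff [simp]: "word_perm a x = word_perm a y \<longleftrightarrow> x = y"
  using bij_word_perm[of a] by (simp add: bij_def inj_eq)

text \<open>Conjugation by \<open>u\<close> carries \<open>transpose i j\<close> to
  \<open>adj c\<close>. This turns a letter acting on values from the left into a reflection acting
  on positions from the right, as a Bruhat step requires.\<close>

lemma adj_comp_eq_comp_transpose:
  assumes "inj u" "u i = c" "u j = Suc c"
  shows "adj c \<circ> u = u \<circ> transpose i j"
proof
  fix x
  have "u x \<noteq> c" if "x \<noteq> i" using that assms(1,2) by (metis injD)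
  moreover have "u x \<noteq> Suc c" if "x \<noteq> j" using that assms(1,3) by (metis injD)
  ultimately show "(adj c \<circ> u) x = (u \<circ> transpose i j) x"
    using assms(2,3) by (cases "x = i"; cases "x = j") (auto simp: adj_def transpose_def)
qed

lemma adj_permutes: "c \<in> {1..n - 1} \<Longrightarrow> adj c permutes {1..n}"
  unfolding adj_def by (intro permutes_swap_id) auto

lemma word_perm_permutes: "set a \<subseteq> {1..n - 1} \<Longrightarrow> word_perm a permutes {1..n}"
proof (induction a)
  case (Cons c a)
  then have "adj c permutes {1..n}" by (intro adj_permutes) simp
  with Cons show ?case by (simp only: word_perm_Cons permutes_compose list.simps insert_subset)
qed (simp add: permutes_id)

lemma adj_braid: "adj k \<circ> adj (Suc k) \<circ> adj k = adj (Suc k) \<circ> adj k \<circ> adj (Suc k)"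
proof
  fix x
  consider "x = k" | "x = Suc k" | "x = Suc (Suc k)"
    | "x \<noteq> k" "x \<noteq> Suc k" "x \<noteq> Suc (Suc k)" by blast
  then show "(adj k \<circ> adj (Suc k) \<circ> adj k) x = (adj (Suc k) \<circ> adj k \<circ> adj (Suc k)) x"
    by cases (simp_all add: adj_def transpose_def)
qed

lemma adj_commute: "d \<noteq> Suc c \<Longrightarrow> c \<noteq> Suc d \<Longrightarrow> adj c \<circ> adj d = adj d \<circ> adj c"
proof
  fix x
  assume *: "d \<noteq> Suc c" "c \<noteq> Suc d"
  consider "x = c" | "x = Suc c" | "x = d" | "x = Suc d"
    | "x \<noteq> c" "x \<noteq> Suc c" "x \<noteq> d" "x \<noteq> Suc d" by blast
  then show "(adj c \<circ> adj d) x = (adj d \<circ> adj c) x"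
    using * by cases (simp_all add: adj_def transpose_def)
qed

text \<open>No letter of \<open>a\<close> is adjacent to \<open>c\<close>, so \<open>adj c\<close>
  passes through one letter at a time. The second premise excludes \<open>c - 1\<close> without
  truncated subtraction at \<open>c = 0\<close>.\<close>

lemma adj_word_perm_commute:
  assumes "Suc c \<notin> set a" "\<And>d. c = Suc d \<Longrightarrow> d \<notin> set a"
  shows "adj c \<circ> word_perm a = word_perm a \<circ> adj c"
  using assms
proof (induction a)
  case (Cons d a)
  have "adj c \<circ> word_perm (d # a) = adj c \<circ> adj d \<circ> word_perm a" by (simp add: comp_assoc)
  also have "\<dots> = adj d \<circ> adj c \<circ> word_perm a"
    using adj_commute[of d c] Cons.prems by fastforce
  also have "\<dots> = adj d \<circ> (word_perm a \<circ> adj c)"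
  proof -
    have "adj c \<circ> word_perm a = word_perm a \<circ> adj c"
      by (rule Cons.IH) (use Cons.prems in auto)
    then show ?thesis by (simp only: comp_assoc)
  qed
  finally show ?case by (simp only: word_perm_Cons comp_assoc)
qed simp

section \<open>Existence of words, length and reduced words\<close>

lemma exists_word_transpose:
  assumes "1 \<le> i" "i < j" "j \<le> n"
  shows "\<exists>a. is_word n (transpose i j) a"
proof -
  have "i + Suc d \<le> n \<Longrightarrow> \<exists>a. is_word n (transpose i (i + Suc d)) a" for d
  proof (induction d)
    case 0
    then have "is_word n (transpose i (i + Suc 0)) [i]"
      using assms(1) by (auto simp: is_word_def adj_def)
    then show ?case ..
  next
    case (Suc d)
    then obtain a where a: "is_word n (transpose i (i + Suc d)) a" by auto
    define k where "k = i + Suc d"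
    \<comment> \<open>Conjugation by \<open>adj k\<close> moves the upper end of
      \<open>transpose i k\<close> from \<open>k\<close> to \<open>Suc k\<close>.\<close>
    have "transpose i (Suc k) = adj k \<circ> transpose i k \<circ> adj k"
      by (auto simp: fun_eq_iff adj_def transpose_def k_def)
    then have "is_word n (transpose i (Suc k)) ([k] @ a @ [k])"
      using a Suc.prems by (auto simp: is_word_def k_def comp_assoc)
    then show ?case by (auto simp: k_def)
  qed
  from this[of "j - Suc i"] assms show ?thesis by auto
qed

lemma exists_word:
  assumes "w permutes {1..n}"
  shows "\<exists>a. is_word n w a"
  using assms finite_atLeastAtMost
proof (induction w rule: permutes_induct)
  case id
  have "is_word n id []" by (simp add: is_word_def)
  then show ?case ..
next
  case (swap i j w)
  then obtain a where a: "is_word n w a" by blast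
  have "\<exists>b. is_word n (transpose i j) b"
  proof (cases "i < j")
    case True
    with swap show ?thesis by (intro exists_word_transpose) auto
  next
    case False
    with swap show ?thesis
      by (subst transpose_commute) (intro exists_word_transpose; auto)
  qed
  then obtain b where "is_word n (transpose i j) b" by blast
  with a have "is_word n (transpose i j \<circ> w) (b @ a)" by (auto simp: is_word_def)
  then show ?case ..
qed

lemma is_word_permutes: "is_word n w a \<Longrightarrow> w permutes {1..n}"
  using word_perm_permutes by (auto simp: is_word_def)

lemma perm_length_le: "is_word n w a \<Longrightarrow> perm_length n w \<le> length a"
  unfolding perm_length_def by (rule Least_le) blast

lemma exists_reduced_word:
  assumes "w permutes {1..n}"
  shows "\<exists>a. reduced_word n w a"
proof -
  from exists_word[OF assms] have "\<exists>l a. is_word n w a \<and> length a = l" by blast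
  from LeastI_ex[OF this] show ?thesis
    unfolding reduced_word_def perm_length_def by blast
qed

lemma reduced_wordI:
  assumes "is_word n w a" "\<And>b. is_word n w b \<Longrightarrow> length a \<le> length b"
  shows "reduced_word n w a"
proof -
  obtain b where "reduced_word n w b"
    using exists_reduced_word[OF is_word_permutes[OF assms(1)]] by blast
  with assms perm_length_le[OF assms(1)] show ?thesis
    by (force simp: reduced_word_def)
qed

section \<open>Deleting a letter, and Bruhat steps as comparisons of values\<close>

lemma exchange:
  assumes "i < j" "word_perm a j < word_perm a i"
  shows "\<exists>b. subseq b a \<and> length b < length a \<and> word_perm b = word_perm a \<circ> transpose i j"
  using assms(2)
proof (induction a)
  case Nil
  with assms(1) show ?case by simp
next
  case (Cons c a)
  show ?case
  proof (cases "word_perm a j < word_perm a i")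
    case True
    then obtain b where b: "subseq b a" "length b < length a"
        "word_perm b = word_perm a \<circ> transpose i j"
      using Cons.IH by blast
    then have "subseq (c # b) (c # a)" "length (c # b) < length (c # a)"
        "word_perm (c # b) = word_perm (c # a) \<circ> transpose i j"
      by (auto simp: comp_assoc)
    then show ?thesis by blast
  next
    case False
    moreover have "word_perm a i \<noteq> word_perm a j" using assms(1) by simp
    ultimately have less: "word_perm a i < word_perm a j" by linarith
    \<comment> \<open>The first letter creates the inversion, and an adjacent transposition reverses
      the order of two values only if they are \<open>c\<close> and \<open>Suc c\<close>. Hence the
      tail \<open>a\<close> itself is the wanted word.\<close>
    have ij: "word_perm a i = c" "word_perm a j = Suc c"
      using less Cons.prems by (auto simp: adj_def transpose_def split: if_splits)
    have "inj (word_perm a)" by (rule bij_is_inj[OF bij_word_perm])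
    from adj_comp_eq_comp_transpose[OF this ij]
    have "word_perm a = word_perm (c # a) \<circ> transpose i j" by (simp add: fun_eq_iff)
    moreover have "subseq a (c # a)" "length a < length (c # a)" by auto
    ultimately show ?thesis by blast
  qed
qed

lemma perm_length_less:
  assumes "w permutes {1..n}" "i < j" "w j < w i"
  shows "perm_length n (w \<circ> transpose i j) < perm_length n w"
proof -
  obtain a where a: "reduced_word n w a" using exists_reduced_word[OF assms(1)] by blast
  then have "word_perm a = w" by (simp add: reduced_word_def is_word_def)
  with exchange[OF assms(2), of a] assms(3) obtain b
    where b: "subseq b a" "length b < length a" "word_perm b = w \<circ> transpose i j" by auto
  then have "is_word n (w \<circ> transpose i j) b"
    using a set_mono_subseq[OF b(1)] by (auto simp: reduced_word_def is_word_def)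
  from perm_length_le[OF this] b(2) a show ?thesis by (simp add: reduced_word_def)
qed

lemma bruhat_step_iff:
  assumes "u permutes {1..n}"
  shows "bruhat_step n u v \<longleftrightarrow>
    (\<exists>i j. 1 \<le> i \<and> i < j \<and> j \<le> n \<and> v = u \<circ> transpose i j \<and> u i < u j)"
proof -
  have "perm_length n u < perm_length n (u \<circ> transpose i j) \<longleftrightarrow> u i < u j"
    if ij: "1 \<le> i" "i < j" "j \<le> n" for i j
  proof -
    have v: "u \<circ> transpose i j permutes {1..n}"
      using ij by (intro permutes_compose assms permutes_swap_id) auto
    have "u i \<noteq> u j" using ij permutes_inj[OF assms] by (auto dest: injD)
    then consider "u i < u j" | "u j < u i" by linarith
    then show ?thesis
    proof cases
      case 1
      \<comment> \<open>\<open>perm_length_less\<close> is applied to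
        \<open>u \<circ> transpose i j\<close>, which has the inversion; the second transposition
        leads back to \<open>u\<close>.\<close>
      then have "perm_length n (u \<circ> transpose i j \<circ> transpose i j)
          < perm_length n (u \<circ> transpose i j)"
        using ij by (intro perm_length_less v) auto
      with 1 show ?thesis by (simp add: comp_assoc)
    next
      case 2
      with perm_length_less[OF assms ij(2)] show ?thesis by simp
    qed
  qed
  then show ?thesis unfolding bruhat_step_def by blast
qed

lemma bruhat_step_permutes:
  assumes "bruhat_step n u v"
  shows "v permutes {1..n} \<longleftrightarrow> u permutes {1..n}"
proof -
  obtain i j where ij: "1 \<le> i" "i < j" "j \<le> n" and v: "v = u \<circ> transpose i j"
    using assms by (auto simp: bruhat_step_def)
  then have t: "transpose i j permutes {1..n}" by (intro permutes_swap_id) auto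
  have "u = v \<circ> transpose i j" by (simp add: v comp_assoc)
  with v show ?thesis using permutes_compose[OF t] by metis
qed

lemma bruhat_le_permutes:
  assumes "bruhat_le n u v"
  shows "v permutes {1..n} \<longleftrightarrow> u permutes {1..n}"
  using assms unfolding bruhat_le_def
  by (induction rule: rtranclp_induct) (use bruhat_step_permutes in blast)+

lemma bruhat_le_refl: "bruhat_le n u u"
  by (simp add: bruhat_le_def)

lemma bruhat_le_trans: "bruhat_le n u v \<Longrightarrow> bruhat_le n v w \<Longrightarrow> bruhat_le n u w"
  by (simp add: bruhat_le_def)

section \<open>The subword property of the Bruhat order\<close>

lemma bruhat_le_imp_subword:
  assumes "bruhat_le n u (word_perm a)" "set a \<subseteq> {1..n - 1}"
  shows "\<exists>b. subseq b a \<and> word_perm b = u"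
  using assms(1) unfolding bruhat_le_def
proof (induction rule: converse_rtranclp_induct)
  case base
  then show ?case by blast
next
  case (step u v)
  then obtain b where b: "subseq b a" "word_perm b = v" by blast
  then have "set b \<subseteq> {1..n - 1}" using assms(2) set_mono_subseq by blast
  then have "v permutes {1..n}" using b(2) word_perm_permutes by blast
  then have "u permutes {1..n}" using step.hyps(1) bruhat_step_permutes by blast
  then obtain i j where ij: "i < j" "v = u \<circ> transpose i j" "u i < u j"
    using step.hyps(1) bruhat_step_iff by blast
  \<comment> \<open>Each step down the chain removes an inversion of the upper element, so
    \<open>exchange\<close> finds the next subword inside the current one.\<close>
  then have "word_perm b j < word_perm b i" by (simp add: b(2))
  from exchange[OF ij(1) this] obtain c where "subseq c b" "word_perm c = u"
    using ij(2) b(2) by (auto simp: comp_assoc)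
  with b(1) show ?case using subseq_order.order_trans by blast
qed

text \<open>Applying \<open>adj c\<close> after \<open>u\<close> can reverse
  \<open>u i < u j\<close> only when these values are \<open>c\<close> and \<open>Suc c\<close>;
  then left multiplication by \<open>adj c\<close> is exactly the given step.\<close>

lemma bruhat_step_adj_comp:
  assumes "bruhat_step n u v" "u permutes {1..n}" "c \<in> {1..n - 1}"
  shows "bruhat_step n (adj c \<circ> u) (adj c \<circ> v) \<or> adj c \<circ> u = v"
proof -
  obtain i j where ij: "1 \<le> i" "i < j" "j \<le> n" "v = u \<circ> transpose i j" "u i < u j"
    using assms(1,2) bruhat_step_iff by blast
  show ?thesis
  proof (cases "adj c (u i) < adj c (u j)")
    case True
    have "adj c \<circ> u permutes {1..n}"
      using assms by (intro permutes_compose adj_permutes)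
    from bruhat_step_iff[OF this] True ij show ?thesis
      by (auto simp: comp_assoc)
  next
    case False
    then have c: "u i = c" "u j = Suc c"
      using ij(5) by (auto simp: adj_def transpose_def split: if_splits)
    from adj_comp_eq_comp_transpose[OF permutes_inj[OF assms(2)] c] ij(4) show ?thesis by blast
  qed
qed

text \<open>A lifting property: going up the chain, steps are carried over by \<open>adj c\<close>
  until one of them is itself multiplication by \<open>adj c\<close>; from there on the original
  chain is followed.\<close>

lemma bruhat_le_adj_comp:
  assumes "bruhat_le n u v" "u permutes {1..n}" "c \<in> {1..n - 1}"
  shows "bruhat_le n (adj c \<circ> u) (adj c \<circ> v) \<or> bruhat_le n (adj c \<circ> u) v"
  using assms(1) unfolding bruhat_le_def
proof (induction rule: rtranclp_induct)
  case base
  then show ?case by blast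
next
  case (step v w)
  have "v permutes {1..n}"
    using step.hyps(1) assms(2) bruhat_le_permutes by (simp add: bruhat_le_def)
  from bruhat_step_adj_comp[OF step.hyps(2) this assms(3)] step.IH step.hyps(2)
  show ?case by (metis rtranclp.rtrancl_into_rtrancl)
qed

lemma reduced_word_ConsD:
  assumes "reduced_word n (adj c \<circ> w) (c # a)"
  shows "reduced_word n w a" "bruhat_step n w (adj c \<circ> w)"
proof -
  have c: "c \<in> {1..n - 1}" and sub: "set a \<subseteq> {1..n - 1}"
    and eq: "adj c \<circ> word_perm a = adj c \<circ> w"
    and len: "perm_length n (adj c \<circ> w) = Suc (length a)"
    using assms by (auto simp: reduced_word_def is_word_def)
  have "adj c \<circ> (adj c \<circ> word_perm a) = adj c \<circ> (adj c \<circ> w)" by (simp only: eq)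
  then have "word_perm a = w" by (simp flip: comp_assoc)
  with sub have a: "is_word n w a" by (simp add: is_word_def)
  show "reduced_word n w a"
  proof (rule reduced_wordI[OF a])
    fix b assume "is_word n w b"
    then have "is_word n (adj c \<circ> w) (c # b)" using c by (auto simp: is_word_def)
    from perm_length_le[OF this] len show "length a \<le> length b" by simp
  qed
  have w: "w permutes {1..n}" using a by (rule is_word_permutes)
  have mem: "w x \<in> {1..n} \<longleftrightarrow> x \<in> {1..n}" for x using permutes_in_image[OF w] .
  obtain i j where i: "w i = c" and j: "w j = Suc c"
    using permutes_surj[OF w] by (metis surjD)
  have range: "i \<in> {1..n}" "j \<in> {1..n}" "i \<noteq> j" using i j mem[of i] mem[of j] c by auto
  have "adj c \<circ> w = w \<circ> transpose i j"
    by (rule adj_comp_eq_comp_transpose[OF permutes_inj[OF w] i j])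
  \<comment> \<open>\<open>bruhat_step\<close> asks for the smaller position first, but
    \<open>i\<close> and \<open>j\<close> may come in either order.\<close>
  then have "adj c \<circ> w = w \<circ> transpose (min i j) (max i j)"
    by (auto simp: min_def max_def transpose_commute)
  moreover have "perm_length n w < perm_length n (adj c \<circ> w)"
    using perm_length_le[OF a] len by simp
  moreover have "1 \<le> min i j \<and> min i j < max i j \<and> max i j \<le> n" using range by auto
  ultimately show "bruhat_step n w (adj c \<circ> w)" unfolding bruhat_step_def by blast
qed

lemma subword_imp_bruhat_le:
  assumes "reduced_word n w a" "subseq b a"
  shows "bruhat_le n (word_perm b) w"
  using assms
proof (induction a arbitrary: b w)
  case Nil
  then have "b = []" "w = id" by (auto simp: reduced_word_def is_word_def)
  then show ?case by (simp only: word_perm_Nil bruhat_le_refl)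
next
  case (Cons c a)
  define v where "v = word_perm a"
  have w: "w = adj c \<circ> v" using Cons.prems(1)
    by (auto simp: reduced_word_def is_word_def v_def)
  have c: "c \<in> {1..n - 1}" using Cons.prems(1) by (simp add: reduced_word_def is_word_def)
  note red = reduced_word_ConsD[OF Cons.prems(1)[unfolded w]]
  have vw: "bruhat_le n v w" using red(2) by (simp add: bruhat_le_def w)
  show ?case
  proof (cases "subseq b a")
    case True
    from Cons.IH[OF red(1) this] vw show ?thesis by (rule bruhat_le_trans)
  next
    case False
    then obtain b' where b: "b = c # b'" "subseq b' a"
      using Cons.prems(2) by (cases b) (auto split: if_splits)
    have le: "bruhat_le n (word_perm b') v" by (rule Cons.IH[OF red(1) b(2)])
    have "v permutes {1..n}" using red(1) is_word_permutes unfolding reduced_word_def by blast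
    then have "word_perm b' permutes {1..n}" using bruhat_le_permutes[OF le] by simp
    \<comment> \<open>Lifting places \<open>adj c \<circ> word_perm b'\<close> below
      \<open>w\<close> or below \<open>v\<close>, and \<open>v\<close> is below
      \<open>w\<close>.\<close>
    from bruhat_le_adj_comp[OF le this c] show ?thesis
      using vw by (metis b(1) w word_perm_Cons bruhat_le_trans)
  qed
qed

section \<open>Interlacing and the braid element\<close>

lemma word_perm_le_iff:
  assumes "k \<notin> set a"
  shows "word_perm a x \<le> k \<longleftrightarrow> x \<le> k"
  \<comment> \<open>A letter other than \<open>k\<close> swaps two numbers on the same side of the
    cut between \<open>k\<close> and \<open>Suc k\<close>.\<close>
  using assms by (induction a) (auto simp: adj_def transpose_def)

text \<open>Keep only the letters \<open>x\<close> and \<open>y\<close> and merge equal neighbours: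
  at most two letters remain, so a single cut separates them.\<close>

lemma not_interlaced_split:
  assumes "x \<noteq> y" "\<not> subseq [x, y, x] a" "\<not> subseq [y, x, y] a"
  shows "\<exists>b c. a = b @ c \<and> (y \<notin> set b \<and> x \<notin> set c \<or> x \<notin> set b \<and> y \<notin> set c)"
  using assms(2,3)
proof (induction a)
  case Nil
  then show ?case by simp
next
  case (Cons d a)
  have "\<not> subseq [x, y, x] a" "\<not> subseq [y, x, y] a" using Cons.prems list_emb_Cons by blast+
  then obtain b c where a: "a = b @ c"
      "y \<notin> set b \<and> x \<notin> set c \<or> x \<notin> set b \<and> y \<notin> set c"
    using Cons.IH by blast
  \<comment> \<open>Generic \<open>p\<close> and \<open>q\<close> allow the roles of
    \<open>x\<close> and \<open>y\<close> to be exchanged, so that the new letter \<open>d\<close>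
    is never \<open>q\<close>.\<close>
  have step: "\<exists>b' c'. d # a = b' @ c' \<and>
      (q \<notin> set b' \<and> p \<notin> set c' \<or> p \<notin> set b' \<and> q \<notin> set c')"
    if "d \<noteq> q" "\<not> subseq [p, q, p] (d # a)"
      "q \<notin> set b \<and> p \<notin> set c \<or> p \<notin> set b \<and> q \<notin> set c" for p q
  proof (cases "q \<notin> set b \<and> p \<notin> set c \<or> d \<noteq> p")
    case True
    with that show ?thesis using a(1) by (intro exI[of _ "d # b"] exI[of _ c]) auto
  next
    case False
    then have d: "d = p" "p \<notin> set b" "q \<notin> set c" using that by auto
    \<comment> \<open>Together with \<open>d = p\<close>, both would yield the pattern
      \<open>p, q, p\<close>. So one of the two letters is missing from \<open>a\<close>, and the
      cut moves to the end or to just after \<open>d\<close>.\<close>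
    have "\<not> (q \<in> set b \<and> p \<in> set c)"
    proof
      assume "q \<in> set b \<and> p \<in> set c"
      then have "subseq ([q] @ [p]) (b @ c)"
        by (intro list_emb_append_mono) (auto simp: subseq_singleton_left)
      with that(2) d(1) a(1) show False by simp
    qed
    then consider "q \<notin> set b" | "p \<notin> set c" by blast
    then show ?thesis
    proof cases
      case 1
      with d that a show ?thesis by (intro exI[of _ "d # a"] exI[of _ "[]"]) auto
    next
      case 2
      with d that a show ?thesis by (intro exI[of _ "[d]"] exI[of _ a]) auto
    qed
  qed
  show ?case
  proof (cases "d = y")
    case False
    with step[of y x] Cons.prems a(2) show ?thesis by blast
  next
    case True
    with step[of x y] assms(1) Cons.prems a(2) show ?thesis by blast
  qed
qed

lemma interlaced_word:
  assumes "word_perm a k = k + 2" "word_perm a (k + 2) = k"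
  shows "subseq [k, Suc k, k] a \<or> subseq [Suc k, k, Suc k] a"
proof (rule ccontr)
  assume "\<not> ?thesis"
  then have "\<not> subseq [k, Suc k, k] a" "\<not> subseq [Suc k, k, Suc k] a" by simp_all
  with not_interlaced_split[of k "Suc k" a] obtain b c where a: "a = b @ c" and
    cases: "Suc k \<notin> set b \<and> k \<notin> set c \<or> k \<notin> set b \<and> Suc k \<notin> set c"
    by (metis n_not_Suc_n)
  \<comment> \<open>The factor \<open>c\<close> acts first. In the first case it leaves
    \<open>k\<close> at most \<open>k\<close>, and \<open>b\<close> cannot lift it past
    \<open>Suc k\<close>; in the second it keeps \<open>k + 2\<close> above \<open>Suc k\<close>,
    and \<open>b\<close> cannot bring it down to \<open>k\<close>.\<close>
  from cases show False
  proof
    assume *: "Suc k \<notin> set b \<and> k \<notin> set c"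
    then have "word_perm c k \<le> Suc k" using word_perm_le_iff[of k c k] by simp
    with * have "word_perm a k \<le> Suc k" by (simp add: a word_perm_le_iff)
    with assms show False by simp
  next
    assume *: "k \<notin> set b \<and> Suc k \<notin> set c"
    then have "\<not> word_perm c (k + 2) \<le> k" using word_perm_le_iff[of "Suc k" c "k + 2"] by simp
    with * have "\<not> word_perm a (k + 2) \<le> k" by (simp add: a word_perm_le_iff)
    with assms show False by simp
  qed
qed

lemma braid_values:
  "(adj k \<circ> adj (k + 1) \<circ> adj k) k = k + 2" "(adj k \<circ> adj (k + 1) \<circ> adj k) (k + 2) = k"
  by (auto simp: adj_def transpose_def)

lemma braid_le_iff_interlaced:
  assumes "w permutes {1..n}" "k \<in> {1..n - 2}"
  shows "adj k \<circ> adj (k + 1) \<circ> adj k \<in> principal_ideal n w \<longleftrightarrow> interlaced n w k"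
    (is "?s \<in> _ \<longleftrightarrow> _")
proof
  assume "?s \<in> principal_ideal n w"
  then have le: "bruhat_le n ?s w" by (simp add: principal_ideal_def)
  have pat: "subseq [k, Suc k, k] a \<or> subseq [Suc k, k, Suc k] a" if a: "reduced_word n w a" for a
  proof -
    obtain b where "subseq b a" "word_perm b = ?s"
      using bruhat_le_imp_subword[of n ?s a] le a by (auto simp: reduced_word_def is_word_def)
    with interlaced_word[of b k] braid_values show ?thesis by (auto dest: subseq_order.order_trans)
  qed
  then have "k \<in> set a \<and> Suc k \<in> set a" if "reduced_word n w a" for a
    using pat[OF that] by (auto dest!: set_mono_subseq)
  with pat exists_reduced_word[OF assms(1)] show "interlaced n w k"
    unfolding interlaced_def by blast
next
  assume "interlaced n w k"
  then obtain a where "reduced_word n w a"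
    "subseq [k, Suc k, k] a \<or> subseq [Suc k, k, Suc k] a" unfolding interlaced_def by blast
  \<comment> \<open>By \<open>adj_braid\<close> both patterns are words of the same
    permutation.\<close>
  then have "bruhat_le n ?s w"
    using subword_imp_bruhat_le[of n w a "[k, Suc k, k]"]
      subword_imp_bruhat_le[of n w a "[Suc k, k, Suc k]"] adj_braid[of k]
    by (auto simp: comp_assoc)
  then show "?s \<in> principal_ideal n w"
    using assms bruhat_le_permutes[of n ?s w] by (simp add: principal_ideal_def)
qed

section \<open>Repeated letters, and words with distinct letters\<close>

lemma reduced_word_repetition:
  assumes "reduced_word n w a" "\<not> distinct a"
  shows "\<exists>k. k \<in> {1..n - 2} \<and> (subseq [k, Suc k, k] a \<or> subseq [Suc k, k, Suc k] a)"
proof -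
  obtain p q r c where a: "a = p @ [c] @ q @ [c] @ r"
    using not_distinct_decomp[OF assms(2)] by blast
  have letters: "set a \<subseteq> {1..n - 1}" using assms(1) by (simp add: reduced_word_def is_word_def)
  have pat: "subseq [c, d, c] a" if "d \<in> set q" for d
  proof -
    have "subseq [d] q" using that by (simp add: subseq_singleton_left)
    then have "subseq ([] @ [c] @ [d] @ [c] @ []) a"
      unfolding a by (intro list_emb_append_mono) auto
    then show ?thesis by simp
  qed
  consider "Suc c \<in> set q" | d where "c = Suc d" "d \<in> set q"
    | "Suc c \<notin> set q" "\<And>d. c = Suc d \<Longrightarrow> d \<notin> set q" by blast
  then show ?thesis
  proof cases
    case 1
    then have "c \<in> {1..n - 2}" using letters by (auto simp: a)
    with pat[OF 1] show ?thesis by blast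
  next
    case 2
    then have "d \<in> {1..n - 2}" using letters by (auto simp: a)
    with pat[OF 2(2)] 2(1) show ?thesis by blast
  next
    case 3
    \<comment> \<open>With no neighbour of \<open>c\<close> in between, the two occurrences meet and
      cancel, which contradicts reducedness.\<close>
    then have "adj c \<circ> word_perm q = word_perm q \<circ> adj c" by (rule adj_word_perm_commute)
    then have "adj c (word_perm q (adj c x)) = word_perm q x" for x
      by (metis adj_adj comp_apply)
    then have "word_perm a = word_perm p \<circ> word_perm q \<circ> word_perm r"
      by (simp add: a fun_eq_iff)
    then have "is_word n w (p @ q @ r)"
      using assms(1) by (auto simp: a reduced_word_def is_word_def comp_assoc)
    from perm_length_le[OF this] assms(1) show ?thesis by (simp add: a reduced_word_def)
  qed
qed

text \<open>Only the letter \<open>k\<close> moves numbers across the cut between \<open>k\<close>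
  and \<open>Suc k\<close>, and a single occurrence is never undone. So the permutation determines
  the letters.\<close>

lemma distinct_word_letter_iff:
  assumes "distinct a"
  shows "k \<in> set a \<longleftrightarrow> (\<exists>x. \<not> (word_perm a x \<le> k \<longleftrightarrow> x \<le> k))"
proof
  assume "k \<in> set a"
  then obtain b c where a: "a = b @ k # c" by (auto simp: in_set_conv_decomp)
  with assms have bc: "k \<notin> set b" "k \<notin> set c" by auto
  obtain x where x: "word_perm c x = k" using bij_word_perm[of c] by (metis bij_pointE)
  then have "x \<le> k" using word_perm_le_iff[OF bc(2), of x] by simp
  moreover have "\<not> word_perm a x \<le> k" using bc x by (simp add: a word_perm_le_iff adj_def)
  ultimately show "\<exists>x. \<not> (word_perm a x \<le> k \<longleftrightarrow> x \<le> k)" by blast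
qed (use word_perm_le_iff in blast)

text \<open>Crossing the cut at \<open>k\<close> forces the letter \<open>k\<close> into every word.
  This minimality makes \<open>a\<close> reduced and later recovers inclusion of letter sets from
  the Bruhat order.\<close>

lemma distinct_word_subset:
  assumes "distinct a" "word_perm a = word_perm b"
  shows "set a \<subseteq> set b"
  using distinct_word_letter_iff[OF assms(1)] word_perm_le_iff[of _ b] assms(2) by auto

lemma distinct_word_reduced:
  assumes "distinct a" "set a \<subseteq> {1..n - 1}"
  shows "reduced_word n (word_perm a) a"
proof (rule reduced_wordI)
  show "is_word n (word_perm a) a" using assms(2) by (simp add: is_word_def)
  fix b assume "is_word n (word_perm a) b"
  then have "set a \<subseteq> set b" using assms(1) by (intro distinct_word_subset) (simp_all add: is_word_def)
  then have "card (set a) \<le> card (set b)" by (simp add: card_mono)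
  also have "\<dots> \<le> length b" by (rule card_length)
  finally show "length a \<le> length b" using assms(1) by (simp add: distinct_card)
qed

text \<open>Each letter has only one place in \<open>a\<close>, so a subword is determined by its
  set of letters; this gives surjectivity onto the ideal in
  \<open>distinct_word_boolean\<close>.\<close>

lemma subseq_distinct_conv_filter:
  assumes "subseq b a" "distinct a"
  shows "b = filter (\<lambda>x. x \<in> set b) a"
  using assms
proof (induction rule: list_emb.induct)
  case (list_emb_Cons b a x)
  then show ?case by (auto dest: set_mono_subseq)
next
  case (list_emb_Cons2 x y b a)
  then have "filter (\<lambda>z. z = y \<or> z \<in> set b) a = filter (\<lambda>z. z \<in> set b) a"
    by (intro filter_cong) auto
  with list_emb_Cons2 show ?case by simp
qed simp

lemma distinct_word_boolean:
  assumes "distinct a" "set a \<subseteq> {1..n - 1}"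
  shows "boolean_perm n (word_perm a)"
proof -
  \<comment> \<open>The candidate isomorphism from sets of letters; each filtered word again has
    distinct letters and is therefore reduced.\<close>
  define g where "g X = word_perm (filter (\<lambda>x. x \<in> X) a)" for X
  have red: "reduced_word n (g X) (filter (\<lambda>x. x \<in> X) a)" for X
    unfolding g_def using assms by (intro distinct_word_reduced) auto
  have g_le: "bruhat_le n (g X) (g Y) \<longleftrightarrow> X \<subseteq> Y" if "X \<subseteq> set a" "Y \<subseteq> set a" for X Y
  proof
    assume "X \<subseteq> Y"
    then have "filter (\<lambda>x. x \<in> X) a = filter (\<lambda>x. x \<in> X) (filter (\<lambda>x. x \<in> Y) a)"
      by (auto intro: filter_cong)
    then have "subseq (filter (\<lambda>x. x \<in> X) a) (filter (\<lambda>x. x \<in> Y) a)"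
      by (metis subseq_filter_left)
    from subword_imp_bruhat_le[OF red this] show "bruhat_le n (g X) (g Y)" by (simp add: g_def)
  next
    assume "bruhat_le n (g X) (g Y)"
    then obtain b where b: "subseq b (filter (\<lambda>x. x \<in> Y) a)" "word_perm b = g X"
      using bruhat_le_imp_subword[of n "g X" "filter (\<lambda>x. x \<in> Y) a"] assms(2)
      by (auto simp: g_def)
    have "set (filter (\<lambda>x. x \<in> X) a) \<subseteq> set b"
      using assms(1) b(2) by (intro distinct_word_subset) (auto simp: g_def)
    also have "\<dots> \<subseteq> set (filter (\<lambda>x. x \<in> Y) a)" using b(1) by (rule set_mono_subseq)
    finally show "X \<subseteq> Y" using that by auto
  qed
  have img: "g ` Pow (set a) = principal_ideal n (word_perm a)"
  proof (intro equalityI subsetI)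
    fix u assume "u \<in> g ` Pow (set a)"
    then obtain X where X: "X \<subseteq> set a" "u = g X" by auto
    have "bruhat_le n u (word_perm a)"
      unfolding X(2) g_def
      by (rule subword_imp_bruhat_le[OF distinct_word_reduced[OF assms]]) simp
    moreover have "u permutes {1..n}"
      unfolding X(2) g_def using assms(2) by (intro word_perm_permutes) auto
    ultimately show "u \<in> principal_ideal n (word_perm a)" by (simp add: principal_ideal_def)
  next
    fix u assume "u \<in> principal_ideal n (word_perm a)"
    then obtain b where b: "subseq b a" "word_perm b = u"
      using bruhat_le_imp_subword[OF _ assms(2)] by (auto simp: principal_ideal_def)
    have "u = g (set b)"
      unfolding g_def using subseq_distinct_conv_filter[OF b(1) assms(1)] b(2) by simp
    then show "u \<in> g ` Pow (set a)" using set_mono_subseq[OF b(1)] by auto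
  qed
  have inj: "inj_on g (Pow (set a))"
  proof (rule inj_onI)
    fix X Y assume "X \<in> Pow (set a)" "Y \<in> Pow (set a)" "g X = g Y"
    then show "X = Y" using g_le[of X Y] g_le[of Y X] by (auto simp: bruhat_le_refl)
  qed
  \<comment> \<open>The letters are renumbered because \<open>boolean_perm\<close> asks for subsets
    of \<open>{1..r}\<close>.\<close>
  obtain h where h: "bij_betw h (set a) {1..length a}"
    using finite_same_card_bij[of "set a" "{1..length a}"] assms(1) by (auto simp: distinct_card)
  define f where "f = (\<lambda>u. h ` the_inv_into (Pow (set a)) g u)"
  have "bij_betw (the_inv_into (Pow (set a)) g) (principal_ideal n (word_perm a)) (Pow (set a))"
    using inj img by (intro bij_betw_the_inv_into) (simp add: bij_betw_def)
  from bij_betw_trans[OF this bij_betw_Pow[OF h]]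
  have "bij_betw f (principal_ideal n (word_perm a)) (Pow {1..length a})"
    by (simp add: f_def comp_def)
  moreover have "bruhat_le n x y \<longleftrightarrow> f x \<subseteq> f y"
    if "x \<in> principal_ideal n (word_perm a)" "y \<in> principal_ideal n (word_perm a)" for x y
  proof -
    have "x \<in> g ` Pow (set a)" "y \<in> g ` Pow (set a)" using that by (simp_all only: img)
    then obtain X Y where XY: "X \<subseteq> set a" "Y \<subseteq> set a" "x = g X" "y = g Y" by auto
    then have "f x = h ` X" "f y = h ` Y"
      by (auto simp: f_def the_inv_into_f_f[OF inj])
    moreover have "h ` X \<subseteq> h ` Y \<longleftrightarrow> X \<subseteq> Y"
      using XY h by (auto simp: bij_betw_def inj_on_def image_subset_iff image_iff) blast
    ultimately show ?thesis using g_le XY by simp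
  qed
  ultimately show ?thesis unfolding boolean_perm_def by blast
qed

section \<open>Non-boolean permutations and the ideal of the braid element\<close>

lemma not_boolean_imp_braid_le:
  assumes "u permutes {1..n}" "\<not> boolean_perm n u"
  shows "\<exists>k \<in> {1..n - 2}. bruhat_le n (adj k \<circ> adj (k + 1) \<circ> adj k) u"
proof -
  obtain a where a: "reduced_word n u a" using exists_reduced_word[OF assms(1)] by blast
  then have "set a \<subseteq> {1..n - 1}" "word_perm a = u" by (simp_all add: reduced_word_def is_word_def)
  then have "\<not> distinct a" using distinct_word_boolean assms(2) by blast
  from reduced_word_repetition[OF a this] obtain k where k: "k \<in> {1..n - 2}"
    and "subseq [k, Suc k, k] a \<or> subseq [Suc k, k, Suc k] a" by blast
  then have "bruhat_le n (adj k \<circ> adj (k + 1) \<circ> adj k) u"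
    using subword_imp_bruhat_le[OF a, of "[k, Suc k, k]"]
      subword_imp_bruhat_le[OF a, of "[Suc k, k, Suc k]"] adj_braid[of k]
    by (auto simp: comp_assoc)
  with k show ?thesis by blast
qed

text \<open>By \<open>interlaced_word\<close> every word of the braid element contains a pattern of
  three letters, so none is shorter.\<close>

lemma braid_reduced_word:
  assumes "k \<in> {1..n - 2}"
  shows "reduced_word n (adj k \<circ> adj (k + 1) \<circ> adj k) [k, k + 1, k]" (is "reduced_word n ?s _")
proof (rule reduced_wordI)
  show "is_word n ?s [k, k + 1, k]" using assms by (auto simp: is_word_def comp_assoc)
  fix b assume "is_word n ?s b"
  then have "subseq [k, Suc k, k] b \<or> subseq [Suc k, k, Suc k] b"
    using interlaced_word[of b k] braid_values[of k] by (auto simp: is_word_def)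
  then show "length [k, k + 1, k] \<le> length b" by (auto dest: list_emb_length)
qed

lemma card_braid_ideal:
  assumes "k \<in> {1..n - 2}"
  shows "card (principal_ideal n (adj k \<circ> adj (k + 1) \<circ> adj k)) = 6"
    (is "card (principal_ideal n ?s) = 6")
proof -
  let ?w = "[k, k + 1, k]"
  have red: "reduced_word n ?s ?w" by (rule braid_reduced_word[OF assms])
  then have w: "set ?w \<subseteq> {1..n - 1}" "word_perm ?w = ?s"
    unfolding reduced_word_def is_word_def by blast+
  have "principal_ideal n ?s = word_perm ` set (subseqs ?w)"
  proof (intro equalityI subsetI)
    fix u assume "u \<in> principal_ideal n ?s"
    then show "u \<in> word_perm ` set (subseqs ?w)"
      using bruhat_le_imp_subword[OF _ w(1), of u] unfolding w(2) set_subseqs_eq principal_ideal_def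
      by blast
  next
    fix u assume "u \<in> word_perm ` set (subseqs ?w)"
    then obtain b where b: "subseq b ?w" "u = word_perm b" unfolding set_subseqs_eq by blast
    have "u permutes {1..n}"
      unfolding b(2) using w(1) set_mono_subseq[OF b(1)] by (intro word_perm_permutes) blast
    with subword_imp_bruhat_le[OF red b(1)] b(2) show "u \<in> principal_ideal n ?s"
      by (simp add: principal_ideal_def)
  qed
  \<comment> \<open>Eight subwords yield six permutations: \<open>[k]\<close> arises twice, and
    \<open>[k, k]\<close> gives \<open>id\<close> like the empty word.\<close>
  also have "\<dots> = {id, adj k, adj (Suc k), adj k \<circ> adj (Suc k), adj (Suc k) \<circ> adj k, ?s}"
    by (auto simp: Let_def comp_assoc)
  also have "card \<dots> = 6" (is "card ?S = 6")
  proof (rule antisym)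
    show "card ?S \<le> 6"
      using card_length[of "[id, adj k, adj (Suc k), adj k \<circ> adj (Suc k), adj (Suc k) \<circ> adj k, ?s]"]
      by simp
    \<comment> \<open>The values at \<open>k\<close> and \<open>Suc k\<close> tell the six elements
      apart: they run through all ordered pairs of distinct numbers among \<open>k\<close>,
      \<open>k + 1\<close>, \<open>k + 2\<close>.\<close>
    have "(\<lambda>p. (p k, p (Suc k))) ` ?S =
        {(k, k + 1), (k + 1, k), (k, k + 2), (k + 1, k + 2), (k + 2, k), (k + 2, k + 1)}"
      by (simp add: adj_def transpose_def)
    moreover have "card \<dots> = 6" by simp
    ultimately show "6 \<le> card ?S"
      using card_image_le[of ?S "\<lambda>p. (p k, p (Suc k))"] by simp
  qed
  finally show ?thesis .
qed

lemma braid_not_boolean: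
  assumes "k \<in> {1..n - 2}"
  shows "\<not> boolean_perm n (adj k \<circ> adj (k + 1) \<circ> adj k)"
proof
  assume "boolean_perm n (adj k \<circ> adj (k + 1) \<circ> adj k)"
  then obtain r :: nat and f
    where "bij_betw f (principal_ideal n (adj k \<circ> adj (k + 1) \<circ> adj k)) (Pow {1..r})"
    unfolding boolean_perm_def by blast
  from bij_betw_same_card[OF this] have "6 = (2::nat) ^ r"
    unfolding card_braid_ideal[OF assms] by (simp add: card_Pow)
  \<comment> \<open>Six is not a power of two because of its factor three.\<close>
  then have "(3::nat) dvd 2 ^ r" by (metis dvd_triv_left mult_2_right numeral_Bit0)
  moreover have "\<not> (3::nat) dvd 2 ^ r" for r
  proof (induction r)
    case (Suc r)
    then show ?case by (simp; presburger)
  qed simp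
  ultimately show False by blast
qed

theorem theorem2p2:
  fixes n :: nat and v w :: "nat \<Rightarrow> nat"
  assumes "n \<ge> 3" and "v permutes {1..n}" and "w permutes {1..n}"
  shows "(\<not> boolean_ideal n (principal_ideal n v \<inter> principal_ideal n w) \<longleftrightarrow>
            (\<exists>k \<in> {1..n - 2}. adj k \<circ> adj (k + 1) \<circ> adj k
               \<in> principal_ideal n v \<inter> principal_ideal n w))
       \<and> (\<not> boolean_ideal n (principal_ideal n v \<inter> principal_ideal n w) \<longleftrightarrow>
            (\<exists>k \<in> {1..n - 2}. interlaced n v k \<and> interlaced n w k))"
proof -
  let ?I = "principal_ideal n v \<inter> principal_ideal n w"
  have "\<not> boolean_ideal n ?I \<longleftrightarrow> (\<exists>k \<in> {1..n - 2}. adj k \<circ> adj (k + 1) \<circ> adj k \<in> ?I)"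
  proof
    assume "\<not> boolean_ideal n ?I"
    then obtain u where u: "u \<in> ?I" "\<not> boolean_perm n u" unfolding boolean_ideal_def by blast
    then obtain k where k: "k \<in> {1..n - 2}" "bruhat_le n (adj k \<circ> adj (k + 1) \<circ> adj k) u"
      using not_boolean_imp_braid_le[of u n] by (auto simp: principal_ideal_def)
    then have "adj k \<circ> adj (k + 1) \<circ> adj k \<in> ?I"
      using u(1) bruhat_le_permutes[OF k(2)] bruhat_le_trans[OF k(2)]
      by (auto simp: principal_ideal_def)
    with k(1) show "\<exists>k \<in> {1..n - 2}. adj k \<circ> adj (k + 1) \<circ> adj k \<in> ?I" by blast
  next
    assume "\<exists>k \<in> {1..n - 2}. adj k \<circ> adj (k + 1) \<circ> adj k \<in> ?I"
    then show "\<not> boolean_ideal n ?I" unfolding boolean_ideal_def using braid_not_boolean by blast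
  qed
  moreover have "(adj k \<circ> adj (k + 1) \<circ> adj k \<in> ?I) \<longleftrightarrow> interlaced n v k \<and> interlaced n w k"
    if "k \<in> {1..n - 2}" for k
    using braid_le_iff_interlaced[OF assms(2) that] braid_le_iff_interlaced[OF assms(3) that]
    by blast
  ultimately show ?thesis by blast
qed

end
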